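(* Let $(L,\leq)$ be a weakly atomic completely semidistributive (complete) lattice. If $L$ is extremal, then the labelling quiver $Q_L$ has no oriented cycles.
   Context: Lattices are complete and possibly infinite; $x\lessdot y$ denotes a cover relation. $L$ is weakly atomic if for all $x<y$ there are $u,v$ with $x\leq u\lessdot v\leq y$. $L$ is completely semidistributive if for all $x\in L$, $S\subseteq L$: if $x\vee y=x\vee z$ for all $y,z\in S$ then $x\vee\bigwedge S=x\vee y$ for all $y\in S$; and dually, if $x\wedge y=x\wedge z$ for all $y,z\in S$ then $x\wedge\bigvee S=x\wedge y$ for all $y\in S$. $\mathrm{JI}^c(L)$ is the set of completely join-irreducible elements: those $x\neq\bigvee\emptyset$ with $x\neq\bigvee S$ for every $S\subseteq\{y\mid y<x\}$; then $x_*:=\bigvee\{y\mid y<x\}$ is the unique lower cover of $x$. $\mathrm{MI}^c(L)$ (completely meet-irreducible elements) is defined dually. For $L$ as in the claim there is a bijection $\kappa:\mathrm{JI}^c(L)\to\mathrm{MI}^c(L)$, $\kappa(j)=\max\{y\in L\mid j\wedge y=j_*\}$ (the maximum exists; known fact). An inclusion-maximal chain $\mathcal X$ in $L$ is extremal if for each $j\in\mathrm{JI}^c(L)$ there are $x<y$ in $\mathcal X$ with $x\vee j=y$ and $y\wedge\kappa(j)=x$. $L$ is extremal if it has an extremal maximal chain. The labelling quiver $Q_L$ is the directed graph with vertex set $\mathrm{JI}^c(L)$ and, for $i,j\in\mathrm{JI}^c(L)$, an arrow $i\to j$ precisely when $i\neq j$ and $i\not\leq\kappa(j)$. *)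

theory Defs
  imports Main "Graph_Theory.Arc_Walk"
begin

definition covered_by :: "'a::order \<Rightarrow> 'a \<Rightarrow> bool" where
  "covered_by x y \<longleftrightarrow> x < y \<and> \<not> (\<exists>z. x < z \<and> z < y)"

text \<open>The lattice under consideration is the whole type. As it only occurs in the type
  of these properties, it is passed as an \<open>itself\<close> argument.\<close>

definition weakly_atomic :: "'a::order itself \<Rightarrow> bool" where
  "weakly_atomic (L :: 'a itself) \<longleftrightarrow>
     (\<forall>x y :: 'a. x < y \<longrightarrow> (\<exists>u v. x \<le> u \<and> covered_by u v \<and> v \<le> y))"

definition completely_semidistributive :: "'a::complete_lattice itself \<Rightarrow> bool" where
  "completely_semidistributive (L :: 'a itself) \<longleftrightarrow>
     (\<forall>(x :: 'a) S. (\<forall>y\<in>S. \<forall>z\<in>S. sup x y = sup x z) \<longrightarrow> (\<forall>y\<in>S. sup x (Inf S) = sup x y)) \<and>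
     (\<forall>(x :: 'a) S. (\<forall>y\<in>S. \<forall>z\<in>S. inf x y = inf x z) \<longrightarrow> (\<forall>y\<in>S. inf x (Sup S) = inf x y))"

definition JIc :: "'a::complete_lattice set" where
  "JIc = {x. x \<noteq> Sup {} \<and> (\<forall>S \<subseteq> {y. y < x}. x \<noteq> Sup S)}"

definition lower_star :: "'a::complete_lattice \<Rightarrow> 'a" where
  "lower_star x = Sup {y. y < x}"

text \<open>Only meaningful for \<open>j \<in> JIc\<close> in a completely semidistributive lattice,
  where the maximum exists by the lemma \<open>kappa_is_greatest\<close> below.\<close>

definition kappa :: "'a::complete_lattice \<Rightarrow> 'a" where
  "kappa j = (GREATEST y. inf j y = lower_star j)"

lemma kappa_is_greatest:
  fixes j :: "'a::complete_lattice"
  assumes "completely_semidistributive TYPE('a)"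
  shows "inf j (kappa j) = lower_star j"
    and "inf j y = lower_star j \<Longrightarrow> y \<le> kappa j"
proof -
  let ?S = "{y. inf j y = lower_star j}"
  have "lower_star j \<le> j"
    unfolding lower_star_def by (auto intro: Sup_least)
  then have "lower_star j \<in> ?S"
    by (simp add: inf.absorb2)
  moreover have "\<forall>y\<in>?S. inf j (Sup ?S) = inf j y"
    using assms[unfolded completely_semidistributive_def, THEN conjunct2, rule_format, of ?S j]
    by simp
  ultimately have max: "inf j (Sup ?S) = lower_star j"
    by (metis (mono_tags, lifting) mem_Collect_eq)
  then have "kappa j = Sup ?S"
    unfolding kappa_def by (intro Greatest_equality) (auto intro: Sup_upper)
  then show "inf j (kappa j) = lower_star j"
    and "inf j y = lower_star j \<Longrightarrow> y \<le> kappa j"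
    using max by (auto intro: Sup_upper)
qed

definition extremal_chain :: "'a::complete_lattice set \<Rightarrow> bool" where
  "extremal_chain X \<longleftrightarrow> pred_on.maxchain UNIV (<) X \<and>
     (\<forall>j\<in>JIc. \<exists>x\<in>X. \<exists>y\<in>X. x < y \<and> sup x j = y \<and> inf y (kappa j) = x)"

definition extremal_lattice :: "'a::complete_lattice itself \<Rightarrow> bool" where
  "extremal_lattice (L :: 'a itself) \<longleftrightarrow> (\<exists>X :: 'a set. extremal_chain X)"

definition labelling_quiver :: "('a::complete_lattice, 'a \<times> 'a) pre_digraph" where
  "labelling_quiver =
     \<lparr> verts = JIc,
       arcs = {(i, j). i \<in> JIc \<and> j \<in> JIc \<and> i \<noteq> j \<and> \<not> i \<le> kappa j},
       tail = fst, head = snd \<rparr>"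

end

theory Submission
  imports Defs
begin

text \<open>
  Extremality attaches to every completely join-irreducible \<open>j\<close> a step \<open>x < y\<close> of a fixed
  maximal chain with \<open>x \<squnion> j = y\<close> and \<open>y \<sqinter> \<kappa>(j) = x\<close>. Such a step is a cover
  (lemma \<open>chain_step_is_cover\<close>), and semidistributivity lets one recover \<open>j\<close> from it
  (lemma \<open>chain_step_determines_label\<close>). So distinct labels occupy distinct,
  non-overlapping steps of the chain, and the chain linearly orders the labels.

  An arrow \<open>i \<rightarrow> j\<close> must go strictly down in this order: were the step \<open>u < v\<close> of \<open>i\<close> below the
  step \<open>x < y\<close> of \<open>j\<close>, then \<open>i \<le> v \<le> x \<le> \<kappa>(j)\<close>, contrary to \<open>i \<notle> \<kappa>(j)\<close>. Hence the lower end
  of the step is a potential that strictly decreases along every arrow, which no closed walk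
  can sustain.
\<close>

definition chain_step :: "'a::complete_lattice \<Rightarrow> 'a \<Rightarrow> 'a \<Rightarrow> bool" where
  "chain_step j x y \<longleftrightarrow> x < y \<and> sup x j = y \<and> inf y (kappa j) = x"

lemma lower_star_less:
  assumes "j \<in> JIc"
  shows "lower_star j < j"
proof -
  have "lower_star j \<le> j"
    unfolding lower_star_def by (auto intro: Sup_least)
  moreover have "lower_star j \<noteq> j"
    using assms unfolding JIc_def lower_star_def mem_Collect_eq by (metis order_refl)
  ultimately show ?thesis by simp
qed

lemma le_lower_star_if_less: "y < j \<Longrightarrow> y \<le> lower_star j"
  unfolding lower_star_def by (simp add: Sup_upper)

lemma chain_step_bounds:
  assumes "chain_step j x y"
  shows "j \<le> y" "x \<le> kappa j" "\<not> j \<le> x"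
proof -
  show "j \<le> y"
    using assms unfolding chain_step_def by (metis sup_ge2)
  show "x \<le> kappa j"
    using assms unfolding chain_step_def by (metis inf_le2)
  show "\<not> j \<le> x"
    using assms unfolding chain_step_def by (metis less_irrefl sup.absorb1)
qed

lemma lower_star_le_chain_step:
  assumes csd: "completely_semidistributive TYPE('a::complete_lattice)"
    and j: "(j :: 'a) \<in> JIc" and step: "chain_step j x y"
  shows "lower_star j \<le> x"
proof -
  have "lower_star j \<le> kappa j"
    using kappa_is_greatest(1)[OF csd, of j] by (metis inf_le2)
  moreover have "lower_star j \<le> y"
    using lower_star_less[OF j] chain_step_bounds(1)[OF step] by simp
  ultimately show ?thesis
    using step unfolding chain_step_def by (metis le_inf_iff)
qed

text \<open>
  An element \<open>z\<close> of the interval either lies above \<open>j\<close>, and then above \<open>x \<squnion> j = y\<close>, or it meets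
  \<open>j\<close> strictly below \<open>j\<close>. In the latter case the meet is exactly the lower cover of \<open>j\<close>,
  because that lower cover already lies below \<open>x\<close>; maximality of \<open>\<kappa>(j)\<close> then
  gives \<open>z \<le> y \<sqinter> \<kappa>(j) = x\<close>.
\<close>

lemma chain_step_is_cover:
  assumes csd: "completely_semidistributive TYPE('a::complete_lattice)"
    and j: "(j :: 'a) \<in> JIc" and step: "chain_step j x y"
  shows "covered_by x y"
proof -
  have False if z: "x < z" "z < y" for z
  proof (cases "j \<le> z")
    case True
    then have "y \<le> z"
      using z step unfolding chain_step_def by (metis le_sup_iff less_imp_le)
    then show False using z by simp
  next
    case False
    then have "inf j z < j"
      by (metis inf.cobounded1 inf.cobounded2 order.not_eq_order_implies_strict)
    then have "inf j z \<le> lower_star j"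
      by (rule le_lower_star_if_less)
    moreover have "lower_star j \<le> inf j z"
      using lower_star_le_chain_step[OF csd j step] lower_star_less[OF j] z
      by (meson le_infI less_imp_le order_trans)
    ultimately have "z \<le> kappa j"
      by (metis kappa_is_greatest(2)[OF csd] antisym)
    then have "z \<le> x"
      using z step unfolding chain_step_def by (metis le_inf_iff less_imp_le)
    then show False using z by simp
  qed
  then show ?thesis
    using step unfolding covered_by_def chain_step_def by blast
qed

text \<open>
  If \<open>i\<close> and \<open>j\<close> both label the step, then \<open>x \<squnion> i = y = x \<squnion> j\<close>, so semidistributivity yields
  \<open>x \<squnion> (i \<sqinter> j) = y\<close>. But every element strictly below \<open>i\<close> or strictly below \<open>j\<close> is
  absorbed by \<open>x\<close>, so \<open>i \<sqinter> j\<close> has to equal both.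
\<close>

lemma chain_step_determines_label:
  assumes csd: "completely_semidistributive TYPE('a::complete_lattice)"
    and i: "(i :: 'a) \<in> JIc" and j: "j \<in> JIc"
    and step_i: "chain_step i x y" and step_j: "chain_step j x y"
  shows "i = j"
proof -
  have "\<forall>v\<in>{i, j}. \<forall>w\<in>{i, j}. sup x v = sup x w"
    using step_i step_j by (auto simp: chain_step_def)
  then have "\<forall>v\<in>{i, j}. sup x (Inf {i, j}) = sup x v"
    using csd[unfolded completely_semidistributive_def, THEN conjunct1] by blast
  then have "sup x (inf i j) = y"
    using step_i by (simp add: chain_step_def)
  then have meet: "\<not> inf i j \<le> x"
    using step_i unfolding chain_step_def by (metis less_irrefl sup.absorb1)
  have eq: "k = inf i j" if "k \<in> JIc" "chain_step k x y" "inf i j \<le> k" for k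
  proof (rule ccontr)
    assume "k \<noteq> inf i j"
    then have "inf i j \<le> lower_star k"
      using that(3) by (intro le_lower_star_if_less) simp
    also have "\<dots> \<le> x"
      using that by (intro lower_star_le_chain_step[OF csd])
    finally show False using meet by simp
  qed
  show ?thesis
    using eq[OF i step_i inf_le1] eq[OF j step_j inf_le2] by (rule trans[OF _ sym])
qed

text \<open>
  The step of \<open>i\<close> cannot end at or below \<open>x\<close>, since \<open>i \<le> v \<le> x \<le> \<kappa>(j)\<close> is excluded.
  As both steps are covers inside one chain, the only other way to avoid
  \<open>x < u\<close> is that the two steps coincide, which would make the labels equal.
\<close>

lemma chain_step_decreases_along_arrow:
  assumes csd: "completely_semidistributive TYPE('a::complete_lattice)"
    and i: "(i :: 'a) \<in> JIc" and j: "j \<in> JIc"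
    and step_i: "chain_step i u v" and step_j: "chain_step j x y"
    and chain: "x \<le> u \<or> u \<le> x" "x \<le> v \<or> v \<le> x" "y \<le> v \<or> v \<le> y"
    and arrow: "i \<noteq> j" "\<not> i \<le> kappa j"
  shows "x < u"
proof -
  have cover_i: "covered_by u v" and cover_j: "covered_by x y"
    using csd i j step_i step_j by (auto intro: chain_step_is_cover)
  have "\<not> v \<le> x"
    using arrow(2) chain_step_bounds(1)[OF step_i] chain_step_bounds(2)[OF step_j]
    by (meson order_trans)
  then have "x < v"
    using chain(2) by auto
  then have "x \<le> u"
    using cover_i chain(1) unfolding covered_by_def by (metis order.not_eq_order_implies_strict)
  moreover have "x \<noteq> u"
  proof
    assume "x = u"
    then have "y = v"
      using cover_i cover_j chain(3) unfolding covered_by_def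
      by (metis order.not_eq_order_implies_strict)
    then show False
      using chain_step_determines_label[OF csd i j] step_i step_j \<open>x = u\<close> arrow(1) by simp
  qed
  ultimately show ?thesis by simp
qed

context pre_digraph
begin

lemma potential_decreases_along_awalk:
  fixes f :: "'a \<Rightarrow> 'c::order"
  assumes decr: "\<And>e. e \<in> arcs G \<Longrightarrow> f (head G e) < f (tail G e)"
    and "awalk u p v" "p \<noteq> []"
  shows "f v < f u"
proof -
  have "f v \<le> f u \<and> (p \<noteq> [] \<longrightarrow> f v < f u)" if "set p \<subseteq> arcs G" "cas u p v"
    using that
  proof (induction p arbitrary: u)
    case (Cons e p)
    then have "f v \<le> f (head G e)" "f (head G e) < f u"
      using decr by auto
    then show ?case by auto
  qed simp
  then show ?thesis
    using assms(2,3) unfolding awalk_def by simp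
qed

lemma no_cycle_if_potential:
  fixes f :: "'a \<Rightarrow> 'c::order"
  assumes "\<And>e. e \<in> arcs G \<Longrightarrow> f (head G e) < f (tail G e)"
  shows "\<not> (\<exists>p. cycle p)"
  using potential_decreases_along_awalk[of f, OF assms] unfolding cycle_def by blast

end

theorem corollary4p15:
  assumes "weakly_atomic TYPE('a::complete_lattice)"
    and "completely_semidistributive TYPE('a)"
    and "extremal_lattice TYPE('a)"
  shows "\<not> (\<exists>p. pre_digraph.cycle (labelling_quiver :: ('a, 'a \<times> 'a) pre_digraph) p)"
proof -
  obtain X :: "'a set" where X: "extremal_chain X"
    using assms(3) unfolding extremal_lattice_def by blast
  have comparable: "a \<le> b \<or> b \<le> a" if "a \<in> X" "b \<in> X" for a b
    using X that unfolding extremal_chain_def pred_on.maxchain_def pred_on.chain_def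
    by (auto simp: less_le)
  have "\<forall>j\<in>JIc. \<exists>x y. x \<in> X \<and> y \<in> X \<and> chain_step j x y"
    using X unfolding extremal_chain_def chain_step_def by blast
  then obtain x y where step: "x j \<in> X" "y j \<in> X" "chain_step j (x j) (y j)"
    if "j \<in> JIc" for j
    by metis
  have "x j < x i" if "i \<in> JIc" "j \<in> JIc" "i \<noteq> j" "\<not> i \<le> kappa j" for i j
    by (rule chain_step_decreases_along_arrow[OF assms(2) that(1,2) step(3)[OF that(1)]
          step(3)[OF that(2)] comparable comparable comparable that(3,4)])
      (simp_all add: step that(1,2))
  then show ?thesis
    by (intro pre_digraph.no_cycle_if_potential[of _ x]) (auto simp: labelling_quiver_def)
qed

end
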